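(* Let $G=(V,E,\omega)$ be a finite directed non-negatively weighted graph, $r\in V$ and $k>0$ an integer, and let $S=\{S_{rv}\}_{v\in V}$ be a solution to the Single-Source Top-$k$ Simple Shortest Paths problem for $G,r,k$. Let $P_{rv}$ be any path from $r$ to a vertex $v\in V$. If (i) $|S_{ru}|=k$ for all vertices $u\in A_{S,v}\setminus\{r\}$, and (ii) $P_{rv}$ is not a prefix of any path in $\bigcup_{u\in A_{S,v}}S_{ru}$, then there exists a solution $S'=\{S'_{ru}\}_{u\in V}$ to the same problem such that $P_{rv}$ is not a prefix of any path in $\bigcup_{u\in V}S'_{ru}$.
   Context: $G=(V,E,\omega)$ is a finite directed graph, $E\subseteq V\times V$, with non-negative real edge weights $\omega$. A path from $s$ to $t$ is a vertex sequence $P=(s=v_1,\dots,v_\eta=t)$, $\eta\ge 1$, with $(v_i,v_{i+1})\in E$ for all $i<\eta$; $V(P)$ is its vertex set; it is simple if it has no repeated vertex; its weight is $\omega(P)=\sum_{i=1}^{\eta-1}\omega(v_i,v_{i+1})$. If $P'$ ends at the first vertex of $P''$, then $P'\oplus P''$ denotes their concatenation; $P'$ is a prefix of $P$ if $P=P'\oplus Q$ for some (possibly empty) $Q$, so every path is a prefix of itself. A collection of top-$k$ simple shortest paths from $r$ to $v$ is a set of pairwise distinct simple paths from $r$ to $v$ that contains all simple $r$–$v$ paths if there are fewer than $k$ of them, and otherwise contains exactly $k$ simple $r$–$v$ paths such that every simple $r$–$v$ path not in the set has weight at least that of every path in the set. $\Gamma_{rv}$ is the family of all such collections ($\Gamma_{rr}=\{\{(r)\}\}$).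 A solution to the Single-Source Top-$k$ Simple Shortest Paths problem is a family $S=\{S_{rv}\}_{v\in V}$ with $S_{rv}\in\Gamma_{rv}$ for every $v\in V$. Write $u\,R_S\,v$ (and say $u$ is a predecessor of $v$) if $u\neq v$ and $u$ lies on some path of $S_{rv}$, and let $T_S$ be the transitive closure of $R_S$. The set of general predecessors of $v$ is $A_{S,v}=\{u: u\,T_S\,v\}\cup\{v\}$. *)

theory Defs
  imports
    Complex_Main
    "HOL-Library.Sublist"
    "Graph_Theory.Pair_Digraph"
    "Graph_Theory.Vertex_Walk"
begin

text \<open>
  Paths are non-empty vertex sequences, possibly with repeated vertices (\<^const>\<open>vwalk\<close>);
  simple paths are the distinct ones (\<^const>\<open>vpath\<close>).
\<close>

definition path_from_to :: "'a pair_pre_digraph \<Rightarrow> 'a \<Rightarrow> 'a \<Rightarrow> 'a vwalk \<Rightarrow> bool" where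
  "path_from_to G s t P \<longleftrightarrow> vwalk P G \<and> hd P = s \<and> last P = t"

definition simple_paths :: "'a pair_pre_digraph \<Rightarrow> 'a \<Rightarrow> 'a \<Rightarrow> 'a vwalk set" where
  "simple_paths G s t = {P. vpath P G \<and> hd P = s \<and> last P = t}"

definition path_weight :: "('a \<times> 'a \<Rightarrow> real) \<Rightarrow> 'a vwalk \<Rightarrow> real" where
  "path_weight \<omega> P = sum_list (map \<omega> (vwalk_arcs P))"

text \<open>
  Concatenation identifies the last vertex of the first path with the first vertex of the
  second one, so the empty continuation is the one-vertex path \<open>Q = [last P']\<close>.
\<close>

definition path_prefix :: "'a pair_pre_digraph \<Rightarrow> 'a vwalk \<Rightarrow> 'a vwalk \<Rightarrow> bool" where
  "path_prefix G P' P \<longleftrightarrow> (\<exists>Q. vwalk Q G \<and> joinable P' Q \<and> P = P' \<oplus> Q)"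

lemma path_prefix_iff_prefix:
  fixes G :: "'a pair_pre_digraph"
  assumes "vwalk P G"
  shows "path_prefix G P' P \<longleftrightarrow> P' \<noteq> [] \<and> prefix P' P"
proof
  assume "path_prefix G P' P"
  then show "P' \<noteq> [] \<and> prefix P' P"
    by (auto simp: path_prefix_def joinable_def vwalk_join_def)
next
  assume asm: "P' \<noteq> [] \<and> prefix P' P"
  then obtain zs where P: "P = P' @ zs" by (auto simp: prefix_def)
  let ?Q = "last P' # zs"
  have J: "joinable P' ?Q" and eq: "P = P' \<oplus> ?Q"
    using asm P by (auto simp: joinable_def vwalk_join_def)
  have "vwalk ?Q G"
    using vwalkI_vwalk_join_r[OF J] assms eq by simp
  with J eq show "path_prefix G P' P"
    unfolding path_prefix_def by blast
qed

text \<open>The family \<open>\<Gamma>\<^bsub>rv\<^esub>\<close> of collections of top-\<open>k\<close> simple shortest paths from \<open>r\<close> to \<open>v\<close>.\<close>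

definition top_k_collections ::
  "'a pair_pre_digraph \<Rightarrow> ('a \<times> 'a \<Rightarrow> real) \<Rightarrow> nat \<Rightarrow> 'a \<Rightarrow> 'a \<Rightarrow> 'a vwalk set set" where
  "top_k_collections G \<omega> k r v =
    {C. C \<subseteq> simple_paths G r v \<and>
        (if card (simple_paths G r v) < k then simple_paths G r v \<subseteq> C
         else card C = k \<and>
           (\<forall>P \<in> simple_paths G r v - C. \<forall>Q \<in> C. path_weight \<omega> Q \<le> path_weight \<omega> P))}"

text \<open>The convention \<open>\<Gamma>\<^bsub>rr\<^esub> = {{(r)}}\<close> is a consequence of the definition.\<close>

lemma simple_paths_refl:
  assumes "r \<in> pverts G"
  shows "simple_paths G r r = {[r]}"
proof -
  have "P = [r]" if "distinct P" "P \<noteq> []" "hd P = r" "last P = r" for P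
    using that by (cases P) (auto split: if_splits)
  then show ?thesis
    using assms by (auto simp: simple_paths_def vpath_def vwalk_def)
qed

lemma top_k_collections_refl:
  assumes "r \<in> pverts G" and "k > 0"
  shows "top_k_collections G \<omega> k r r = {{[r]}}"
  using assms
  by (auto simp: top_k_collections_def simple_paths_refl subset_singleton_iff)

definition top_k_solution ::
  "'a pair_pre_digraph \<Rightarrow> ('a \<times> 'a \<Rightarrow> real) \<Rightarrow> 'a \<Rightarrow> nat \<Rightarrow> ('a \<Rightarrow> 'a vwalk set) \<Rightarrow> bool" where
  "top_k_solution G \<omega> r k S \<longleftrightarrow> (\<forall>v \<in> pverts G. S v \<in> top_k_collections G \<omega> k r v)"

text \<open>
  The predecessor relation is restricted to \<open>pverts G\<close> because a family \<open>S\<close> is a total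
  function whose values outside the vertex set are irrelevant.
\<close>

definition predecessor_rel :: "'a pair_pre_digraph \<Rightarrow> ('a \<Rightarrow> 'a vwalk set) \<Rightarrow> 'a rel" where
  "predecessor_rel G S =
    {(u, v). u \<in> pverts G \<and> v \<in> pverts G \<and> u \<noteq> v \<and> (\<exists>P \<in> S v. u \<in> set P)}"

definition general_predecessors ::
  "'a pair_pre_digraph \<Rightarrow> ('a \<Rightarrow> 'a vwalk set) \<Rightarrow> 'a \<Rightarrow> 'a set" where
  "general_predecessors G S v = {u. (u, v) \<in> (predecessor_rel G S)\<^sup>+} \<union> {v}"

end

theory Submission
  imports Defs
begin

text \<open>
  Let \<open>A\<close> be the set of general predecessors of \<open>v\<close> and let \<open>Q\<close> be a simple path from \<open>r\<close> to \<open>w\<close>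
  with prefix \<open>P\<close>. If \<open>x\<close> is the last vertex of \<open>Q\<close> in \<open>A\<close>, then the part of \<open>Q\<close> up to \<open>x\<close> has
  prefix \<open>P\<close>, so it is not in \<open>S\<^bsub>rx\<^esub>\<close> and is at least as heavy as each of the \<open>k\<close> paths in
  \<open>S\<^bsub>rx\<^esub>\<close>. These stay inside \<open>A\<close>, whereas the rest of \<open>Q\<close> avoids \<open>A\<close>. Hence replacing the initial
  part of \<open>Q\<close> by them yields \<open>k\<close> simple paths from \<open>r\<close> to \<open>w\<close> that are no heavier than \<open>Q\<close> and
  do not have prefix \<open>P\<close>. So the \<open>k\<close> lightest among the simple paths without prefix \<open>P\<close> are
  also lightest among all simple paths.
\<close>

lemma ex_least_subset_card:
  fixes f :: "'b \<Rightarrow> 'c::linorder"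
  assumes "finite A" and "k \<le> card A"
  shows "\<exists>C \<subseteq> A. card C = k \<and> (\<forall>p \<in> A - C. \<forall>q \<in> C. f q \<le> f p)"
  using assms(2)
proof (induction k)
  case 0
  then show ?case by (intro exI[of _ "{}"]) auto
next
  case (Suc k)
  then obtain C where C: "C \<subseteq> A" "card C = k" "\<forall>p \<in> A - C. \<forall>q \<in> C. f q \<le> f p"
    by auto
  from C Suc.prems have "A - C \<noteq> {}" by auto
  \<comment> \<open>A lightest element outside \<open>C\<close> enlarges it: by the induction
    hypothesis it is no lighter than any member of \<open>C\<close>.\<close>
  with \<open>finite A\<close> obtain m where m: "m \<in> A - C" "\<forall>p \<in> A - C. f m \<le> f p"
    using ex_min_if_finite[of "f ` (A - C)"] by (auto simp: not_less)
  have "finite C" using C(1) \<open>finite A\<close> finite_subset by blast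
  with C m show ?case
    by (intro exI[of _ "insert m C"]) auto
qed

lemma finite_simple_paths:
  fixes G :: "'a pair_pre_digraph"
  assumes "finite (pverts G)"
  shows "finite (simple_paths G s t)"
  by (rule finite_subset[OF _ finite_subset_distinct[OF assms]])
    (auto simp: simple_paths_def vpath_def vwalk_def)

lemma simple_paths_appendD:
  fixes G :: "'a pair_pre_digraph"
  assumes "ys @ x # zs \<in> simple_paths G r w"
  shows "ys @ [x] \<in> simple_paths G r x"
  using assms vwalkI_append_l[of "ys @ [x]" zs "with_proj G"]
  by (auto simp: simple_paths_def vpath_def hd_append split: if_splits)

text \<open>Disjointness from \<open>zs\<close> keeps the new path simple; the common end
  \<open>x\<close> supplies the arc into \<open>zs\<close>.\<close>

lemma simple_paths_replace_initial_segment: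
  fixes G :: "'a pair_pre_digraph"
  assumes "ys @ x # zs \<in> simple_paths G r w" and T: "T \<in> simple_paths G r x"
    and "set T \<inter> set zs = {}"
  shows "T @ zs \<in> simple_paths G r w"
proof -
  have "T \<noteq> []" "last T = x" "hd T = r" "vwalk T G"
    using T by (auto simp: simple_paths_def vpath_def vwalk_def)
  moreover from this have "joinable T (x # zs)" by simp
  moreover have "vwalk (x # zs) G"
    using assms(1) by (auto simp: simple_paths_def vpath_def intro: vwalkI_append_r)
  ultimately have "vwalk (T @ zs) G"
    using vwalk_joinI_vwalk[of T "with_proj G" "x # zs"] by (simp add: vwalk_join_def)
  with assms \<open>T \<noteq> []\<close> \<open>last T = x\<close> \<open>hd T = r\<close> show ?thesis
    by (auto simp: simple_paths_def vpath_def)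
qed

text \<open>The second summand starts at \<open>x\<close> so that the arc from \<open>T\<close> into
  a non-empty \<open>zs\<close> is counted.\<close>

lemma path_weight_append:
  assumes "T \<noteq> []" and "last T = x"
  shows "path_weight \<omega> (T @ zs) = path_weight \<omega> T + path_weight \<omega> (x # zs)"
  using vwalk_join_arcs[of T "x # zs"] assms
  by (simp add: path_weight_def vwalk_join_def)

lemma top_k_collections_weight_le:
  assumes "C \<in> top_k_collections G \<omega> k r v" and "P \<in> simple_paths G r v - C" and "Q \<in> C"
  shows "path_weight \<omega> Q \<le> path_weight \<omega> P"
  using assms by (auto simp: top_k_collections_def split: if_splits)

text \<open>This is the exchange argument. Of the general predecessors it keeps only closure: the
  paths chosen for a vertex of \<open>A\<close> stay in \<open>A\<close>.\<close>

lemma light_simple_paths_avoiding_prefix: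
  fixes G :: "'a pair_pre_digraph"
  assumes "v \<in> A" and P: "P \<in> simple_paths G r v"
    and top: "\<And>u. u \<in> A \<Longrightarrow> S u \<in> top_k_collections G \<omega> k r u"
    and closed: "\<And>u T. u \<in> A \<Longrightarrow> T \<in> S u \<Longrightarrow> set T \<subseteq> A"
    and full: "\<And>u. u \<in> A - {r} \<Longrightarrow> card (S u) = k"
    and no_prefix: "\<And>u T. u \<in> A \<Longrightarrow> T \<in> S u \<Longrightarrow> \<not> prefix P T"
    and "v \<noteq> r" and Q: "Q \<in> simple_paths G r w" and "prefix P Q"
  shows "\<exists>U \<subseteq> simple_paths G r w. card U = k \<and>
    (\<forall>T \<in> U. \<not> prefix P T \<and> path_weight \<omega> T \<le> path_weight \<omega> Q)"
proof -
  have PD: "P \<noteq> []" "hd P = r" "last P = v" "distinct P"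
    using P by (auto simp: simple_paths_def vpath_def vwalk_def)
  have "v \<in> set Q" using PD \<open>prefix P Q\<close> by (metis last_in_set set_mono_prefix subsetD)
  with \<open>v \<in> A\<close> have "\<exists>x \<in> set Q. x \<in> A" by auto
  then obtain ys x zs where Qeq: "Q = ys @ x # zs" and x: "x \<in> A"
    and zs: "\<forall>z \<in> set zs. z \<notin> A"
    by (rule split_list_last_propE)
  have initial: "ys @ [x] \<in> simple_paths G r x"
    using Q simple_paths_appendD Qeq by metis
  \<comment> \<open>Otherwise \<open>P\<close> runs past \<open>x\<close>, so its end
    \<open>v\<close> lies in \<open>zs\<close>, which avoids \<open>A\<close>.\<close>
  have prefix_initial: "prefix P (ys @ [x])"
  proof (rule ccontr)
    assume "\<not> prefix P (ys @ [x])"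
    moreover have "prefix P ((ys @ [x]) @ zs)" using \<open>prefix P Q\<close> Qeq by simp
    ultimately obtain us where us: "P = (ys @ [x]) @ us" "prefix us zs"
      by (subst (asm) (2) prefix_append) auto
    with \<open>\<not> prefix P (ys @ [x])\<close> have "us \<noteq> []" by auto
    with us PD have "v \<in> set zs" by (metis last_appendR last_in_set set_mono_prefix subsetD)
    with zs \<open>v \<in> A\<close> show False by auto
  qed
  \<comment> \<open>Only away from \<open>r\<close> does \<open>full\<close> provide
    \<open>k\<close> paths. At \<open>x = r\<close> simplicity would shrink the initial part to
    \<open>[r]\<close>, forcing \<open>v = r\<close>.\<close>
  have "x \<noteq> r"
  proof
    assume "x = r"
    then have "ys @ [x] = [r]"
      using initial
      by (cases ys) (auto simp: simple_paths_def vpath_def)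
    with prefix_initial PD \<open>v \<noteq> r\<close> show False by (cases P) auto
  qed
  have SD: "T \<in> simple_paths G r x" "T \<noteq> []" "last T = x" "set T \<subseteq> A" "\<not> prefix P T"
    if "T \<in> S x" for T
    using that top[OF x] closed[OF x] no_prefix[OF x]
    by (auto simp: top_k_collections_def simple_paths_def vpath_def vwalk_def)
  let ?U = "(\<lambda>T. T @ zs) ` S x"
  have "card ?U = k"
    using full x \<open>x \<noteq> r\<close> by (simp add: card_image inj_on_def)
  moreover have "?U \<subseteq> simple_paths G r w"
    using simple_paths_replace_initial_segment Q Qeq SD(1,4) zs by fast
  \<comment> \<open>As \<open>P\<close> is not a prefix of \<open>T\<close>, it would have to end
    inside \<open>zs\<close>, again putting \<open>v\<close> there.\<close>
  moreover have "\<not> prefix P (T @ zs)" if T: "T \<in> S x" for T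
  proof
    assume "prefix P (T @ zs)"
    then obtain us where us: "P = T @ us" "prefix us zs"
      using SD(5)[OF T] by (auto simp: prefix_append)
    with SD(5)[OF T] have "us \<noteq> []" by auto
    with us PD have "v \<in> set zs" by (metis last_appendR last_in_set set_mono_prefix subsetD)
    with zs \<open>v \<in> A\<close> show False by auto
  qed
  moreover have "path_weight \<omega> (T @ zs) \<le> path_weight \<omega> Q" if T: "T \<in> S x" for T
  proof -
    have "ys @ [x] \<notin> S x" using prefix_initial no_prefix x by blast
    then have "path_weight \<omega> T \<le> path_weight \<omega> (ys @ [x])"
      using top_k_collections_weight_le[OF top[OF x]] initial T by blast
    then show ?thesis
      using path_weight_append[of T x \<omega> zs] path_weight_append[of "ys @ [x]" x \<omega> zs] SD[OF T] Qeq
      by simp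
  qed
  ultimately show ?thesis by blast
qed

text \<open>Let \<open>C\<close> consist of \<open>k\<close> lightest paths of \<open>M\<close>. For
  a path \<open>p\<close> outside \<open>M\<close>, the set \<open>U\<close> of \<open>k\<close>
  paths no heavier than \<open>p\<close> either equals \<open>C\<close> or contains some
  \<open>T\<close> in \<open>M - C\<close>; such a \<open>T\<close> is at least as heavy as every
  path in \<open>C\<close>.\<close>

lemma ex_top_k_collection_in_subset:
  fixes G :: "'a pair_pre_digraph"
  assumes "finite (pverts G)" and "M \<subseteq> simple_paths G r w" and "M \<noteq> simple_paths G r w"
    and light: "\<And>Q. Q \<in> simple_paths G r w - M \<Longrightarrow>
      \<exists>U \<subseteq> M. card U = k \<and> (\<forall>T \<in> U. path_weight \<omega> T \<le> path_weight \<omega> Q)"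
  shows "\<exists>C \<in> top_k_collections G \<omega> k r w. C \<subseteq> M"
proof -
  have fin: "finite (simple_paths G r w)" using finite_simple_paths assms(1) .
  then have finM: "finite M" using assms(2) finite_subset by blast
  \<comment> \<open>Some path lies outside \<open>M\<close>, and its set \<open>U\<close> already
    supplies \<open>k\<close> elements of \<open>M\<close>.\<close>
  have "k \<le> card M"
    using light assms(2,3) card_mono[OF finM] by blast
  then obtain C where C: "C \<subseteq> M" "card C = k"
    "\<forall>p \<in> M - C. \<forall>q \<in> C. path_weight \<omega> q \<le> path_weight \<omega> p"
    using ex_least_subset_card[OF finM, of k "path_weight \<omega>"] by blast
  have finC: "finite C" using C(1) finM finite_subset by blast
  have "path_weight \<omega> q \<le> path_weight \<omega> p" if p: "p \<in> simple_paths G r w - C" and q: "q \<in> C" for p q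
  proof (cases "p \<in> M")
    case True
    with C p q show ?thesis by blast
  next
    case False
    then obtain U where U: "U \<subseteq> M" "card U = k" "\<forall>T \<in> U. path_weight \<omega> T \<le> path_weight \<omega> p"
      using light p by blast
    show ?thesis
    proof (cases "U \<subseteq> C")
      case True
      then have "U = C" using card_subset_eq[OF finC] U(2) C(2) by simp
      with U(3) q show ?thesis by blast
    next
      case False
      then obtain T where "T \<in> U" "T \<in> M - C" using U(1) by blast
      with C(3) U(3) q show ?thesis by (meson order_trans)
    qed
  qed
  moreover have "\<not> card (simple_paths G r w) < k"
    using \<open>k \<le> card M\<close> card_mono[OF fin assms(2)] by simp
  ultimately have "C \<in> top_k_collections G \<omega> k r w"
    using C(1,2) assms(2) by (auto simp: top_k_collections_def)
  with C(1) show ?thesis by blast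
qed

theorem lemma6:
  fixes G :: "'a pair_pre_digraph" and \<omega> :: "'a \<times> 'a \<Rightarrow> real"
    and r v :: 'a and k :: nat and S :: "'a \<Rightarrow> 'a vwalk set" and P :: "'a vwalk"
  assumes "pair_fin_digraph G"
    and "\<And>e. e \<in> parcs G \<Longrightarrow> 0 \<le> \<omega> e"
    and "r \<in> pverts G" and "k > 0"
    and "top_k_solution G \<omega> r k S"
    and "v \<in> pverts G" and "path_from_to G r v P"
    and "\<And>u. u \<in> general_predecessors G S v - {r} \<Longrightarrow> card (S u) = k"
    and "\<not> (\<exists>Q \<in> (\<Union>u \<in> general_predecessors G S v. S u). path_prefix G P Q)"
  shows "\<exists>S'. top_k_solution G \<omega> r k S' \<and>
    \<not> (\<exists>Q \<in> (\<Union>u \<in> pverts G. S' u). path_prefix G P Q)"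
proof -
  let ?A = "general_predecessors G S v"
  have fin: "finite (pverts G)"
    using assms(1) by (rule pair_fin_digraph.pair_finite_verts)
  have PD: "vwalk P G" "hd P = r" "last P = v" "P \<noteq> []"
    using assms(7) by (auto simp: path_from_to_def)
  have pp: "path_prefix G P T \<longleftrightarrow> prefix P T" if "T \<in> simple_paths G r u" for T u
    using that path_prefix_iff_prefix[of T G P] PD(4) by (auto simp: simple_paths_def vpath_def)
  have top: "S u \<in> top_k_collections G \<omega> k r u" if "u \<in> pverts G" for u
    using assms(5) that by (simp add: top_k_solution_def)
  have A_verts: "?A \<subseteq> pverts G"
    using assms(6) by (auto simp: general_predecessors_def predecessor_rel_def elim: tranclE converse_tranclE)
  have simple: "S u \<subseteq> simple_paths G r u" if "u \<in> pverts G" for u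
    using top[OF that] by (simp add: top_k_collections_def)
  have closed: "set T \<subseteq> ?A" if u: "u \<in> ?A" and T: "T \<in> S u" for u T
  proof
    fix y assume "y \<in> set T"
    have "u \<in> pverts G" using u A_verts by blast
    with simple T \<open>y \<in> set T\<close> have "y \<in> pverts G"
      by (fastforce simp: simple_paths_def vpath_def vwalk_def)
    with \<open>u \<in> pverts G\<close> \<open>y \<in> set T\<close> T have "y = u \<or> (y, u) \<in> predecessor_rel G S"
      by (auto simp: predecessor_rel_def)
    with u show "y \<in> ?A"
      by (auto simp: general_predecessors_def intro: trancl_into_trancl2)
  qed
  have no_prefix: "\<not> prefix P T" if "u \<in> ?A" "T \<in> S u" for u T
    using assms(9) that pp simple A_verts by blast
  have v: "v \<in> ?A" by (simp add: general_predecessors_def)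
  \<comment> \<open>The collections for different \<open>w\<close> are independent, so
    \<open>S'\<close> can be chosen vertex by vertex. If no simple path to \<open>w\<close> has
    prefix \<open>P\<close>, as when \<open>P\<close> is not simple, \<open>S w\<close> itself
    serves.\<close>
  have "\<exists>C \<in> top_k_collections G \<omega> k r w. \<forall>T \<in> C. \<not> prefix P T" if w: "w \<in> pverts G" for w
  proof (cases "\<exists>Q \<in> simple_paths G r w. prefix P Q")
    case False
    with top simple w show ?thesis by blast
  next
    case True
    then have "distinct P"
      by (auto simp: simple_paths_def vpath_def prefix_def)
    with PD have P: "P \<in> simple_paths G r v" by (auto simp: simple_paths_def)
    \<comment> \<open>For \<open>v = r\<close> the simple path \<open>P\<close> would be
      \<open>[r]\<close>, the only member of \<open>S r\<close>, against hypothesis (ii).\<close>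
    have "v \<noteq> r"
    proof
      assume "v = r"
      then have "P = [r]" and "S v = {[r]}"
        using P top[OF assms(6)] simple_paths_refl[OF assms(3)]
          top_k_collections_refl[OF assms(3,4)] by auto
      with no_prefix v show False by blast
    qed
    let ?M = "{T \<in> simple_paths G r w. \<not> prefix P T}"
    have "\<exists>U \<subseteq> ?M. card U = k \<and> (\<forall>T \<in> U. path_weight \<omega> T \<le> path_weight \<omega> Q)"
      if "Q \<in> simple_paths G r w - ?M" for Q
    proof -
      have Q: "Q \<in> simple_paths G r w" "prefix P Q" using that by auto
      have "\<exists>U \<subseteq> simple_paths G r w. card U = k \<and>
          (\<forall>T \<in> U. \<not> prefix P T \<and> path_weight \<omega> T \<le> path_weight \<omega> Q)"
        using v P top[OF subsetD[OF A_verts]] closed assms(8) no_prefix \<open>v \<noteq> r\<close> Q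
        by (rule light_simple_paths_avoiding_prefix)
      then show ?thesis by blast
    qed
    moreover have "?M \<noteq> simple_paths G r w" using True by blast
    ultimately have "\<exists>C \<in> top_k_collections G \<omega> k r w. C \<subseteq> ?M"
      by (intro ex_top_k_collection_in_subset[OF fin]) auto
    then show ?thesis by blast
  qed
  then obtain S' where S': "\<And>w. w \<in> pverts G \<Longrightarrow>
      S' w \<in> top_k_collections G \<omega> k r w \<and> (\<forall>T \<in> S' w. \<not> prefix P T)"
    by metis
  then have "top_k_solution G \<omega> r k S'" by (simp add: top_k_solution_def)
  moreover have "\<not> path_prefix G P T" if "w \<in> pverts G" "T \<in> S' w" for w T
    using S'[OF that(1)] that(2) pp by (auto simp: top_k_collections_def)
  ultimately show ?thesis by blast
qed

end
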